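(* Let $p\geq 5$ be an odd prime with $p \equiv 3 \pmod{4}$ and write $p-1=2r$ with $r>1$ odd; let $m:=\operatorname{ord}_r(2)$. Then the following are equivalent: (i) $2p \in S_k$ for at least one $k\ge 0$; (ii) $-1 \in \langle 2\rangle$ in $(\mathbb{Z}/r\mathbb{Z})^\times$; (iii) there exists $t_0\ge 1$ with $2^{t_0}\equiv -1 \pmod r$, and for the least such $t_0$ we have $m=2t_0$. When any one of (i)–(iii) holds, the set of all $k\ge 0$ with $2p\in S_k$ is the infinite arithmetic progression of $k\ge 0$ with $k \equiv t_0-1 \pmod{2t_0}$, where $t_0$ is the least positive integer with $2^{t_0}\equiv -1\pmod r$; equivalently, $k \equiv \frac{m}{2}-1 \pmod m$.
   Context: For integers $k\ge 0$ and $n\ge 1$, $\sigma_k(n)=\sum_{d\mid n} d^k$ and $\phi(n)$ is Euler's totient function. For each $k\geq 0$, $S_k$ denotes the set of composite positive integers $n$ satisfying $n\cdot\sigma_k(n)\equiv 2 \pmod{\phi(n)}$. $\operatorname{ord}_r(2)$ is the multiplicative order of $2$ modulo $r$, and $\langle 2\rangle$ is the subgroup of $(\mathbb{Z}/r\mathbb{Z})^\times$ generated by $2$. *)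

theory Defs
  imports "HOL-Number_Theory.Number_Theory" "HOL-Algebra.Generated_Groups"
begin

definition divisor_sigma :: "nat \<Rightarrow> nat \<Rightarrow> nat" where
  "divisor_sigma k n = (\<Sum>d | d dvd n. d ^ k)"

definition composite :: "nat \<Rightarrow> bool" where
  "composite n \<longleftrightarrow> n > 1 \<and> \<not> prime n"

definition S :: "nat \<Rightarrow> nat set" where
  "S k = {n. composite n \<and> [n * divisor_sigma k n = 2] (mod totient n)}"

definition neg_one_exponent :: "nat \<Rightarrow> nat \<Rightarrow> bool" where
  "neg_one_exponent r t \<longleftrightarrow> t \<ge> 1 \<and> [(2::int) ^ t = - 1] (mod int r)"

(* Elements of the residue ring are represented by integers in {0..r-1}. *)
definition neg_one_in_gen_two :: "nat \<Rightarrow> bool" where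
  "neg_one_in_gen_two r \<longleftrightarrow>
     (- 1) mod int r \<in> generate (units_of (residue_ring (int r))) {2 mod int r}"

end

theory Submission
  imports Defs
begin

text \<open>
  Since \<open>p \<equiv> 1\<close> modulo \<open>r\<close> and \<open>\<phi> (2p) = 2r\<close>, the defining congruence of \<open>S\<^sub>k\<close> at \<open>2p\<close> collapses to
  \<open>2 (1 + 2\<^sup>k) \<equiv> 1\<close>, i.e. \<open>2 ^ (k + 1) \<equiv> -1\<close> modulo \<open>r\<close>. Solvability of this is membership of
  \<open>-1\<close> in \<open>\<langle>2\<rangle>\<close>; the least solution \<open>t\<^sub>0\<close> satisfies \<open>t\<^sub>0 < m\<close> and \<open>m dvd 2 t\<^sub>0\<close>, hence \<open>m = 2 t\<^sub>0\<close>,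
  and the solutions form one residue class modulo \<open>m\<close>.
\<close>

lemma divisors_two_prime:
  fixes p :: nat
  assumes "prime p"
  shows "{d. d dvd 2 * p} = {1, 2, p, 2 * p}"
proof (intro equalityI subsetI)
  fix d assume "d \<in> {d. d dvd 2 * p}"
  then obtain a b where "d = a * b" "a dvd 2" "b dvd p"
    by (auto elim: dvd_productE)
  moreover have "a = 1 \<or> a = 2" "b = 1 \<or> b = p"
    using \<open>a dvd 2\<close> \<open>b dvd p\<close> assms two_is_prime_nat by (auto simp: prime_nat_iff)
  ultimately show "d \<in> {1, 2, p, 2 * p}" by auto
qed auto

lemma divisor_sigma_two_prime:
  assumes "prime p" "odd p"
  shows "divisor_sigma k (2 * p) = (1 + 2 ^ k) * (1 + p ^ k)"
proof -
  \<comment> \<open>These inequalities make the four divisors distinct, so the sum over the set has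
    four separate terms.\<close>
  have "p \<noteq> 0" "p \<noteq> 1" "p \<noteq> 2" using assms by auto
  then show ?thesis
    unfolding divisor_sigma_def divisors_two_prime[OF assms(1)]
    by (simp add: power_mult_distrib algebra_simps)
qed

lemma two_prime_mem_S_iff:
  assumes "prime p" "p = 2 * r + 1"
  shows "2 * p \<in> S k \<longleftrightarrow> neg_one_exponent r (k + 1)"
proof -
  have "odd p" using assms(2) by simp
  have "p \<ge> 2" using assms(1) prime_ge_2_nat by blast
  have "composite (2 * p)"
    using \<open>p \<ge> 2\<close> prime_product[of 2 p] by (auto simp: composite_def)
  moreover have "totient (2 * p) = 2 * r"
    using \<open>odd p\<close> totient_prime[OF assms(1)] assms(2) totient_double[of p] by simp
  ultimately have "2 * p \<in> S k \<longleftrightarrow> [2 * (p * ((1 + 2 ^ k) * (1 + p ^ k))) = 2 * 1] (mod (2 * r))"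
    using divisor_sigma_two_prime[OF assms(1) \<open>odd p\<close>] by (simp add: S_def mult.assoc)
  \<comment> \<open>The factor \<open>2\<close> cancels from both sides and from the
    modulus.\<close>
  also have "\<dots> \<longleftrightarrow> [p * ((1 + 2 ^ k) * (1 + p ^ k)) = 1] (mod r)"
    by (simp only: cong_def mult_mod_right[symmetric]) simp
  also have "\<dots> \<longleftrightarrow> [1 * ((1 + 2 ^ k) * (1 + 1 ^ k)) = 1] (mod r)"
  proof -
    have "[2 * r + 1 = 0 + 1] (mod r)" by (intro cong_add cong_refl) (simp add: cong_0_iff)
    then have "[p = 1] (mod r)" using assms(2) by simp
    then have "[p * ((1 + 2 ^ k) * (1 + p ^ k)) = 1 * ((1 + 2 ^ k) * (1 + 1 ^ k))] (mod r)"
      by (intro cong_mult cong_add cong_pow cong_refl)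
    then show ?thesis by (simp only: cong_def)
  qed
  also have "\<dots> \<longleftrightarrow> [int (1 * ((1 + 2 ^ k) * (1 + 1 ^ k))) = int 1] (mod int r)"
    by (simp only: cong_int_iff)
  \<comment> \<open>The difference of the two sides is
    \<open>2 * (1 + 2 ^ k) - 1 = 2 ^ (k + 1) - (- 1)\<close>; over the naturals \<open>- 1\<close>
    would not be available.\<close>
  also have "\<dots> \<longleftrightarrow> neg_one_exponent r (k + 1)"
    by (simp add: neg_one_exponent_def cong_iff_dvd_diff algebra_simps)
  finally show ?thesis .
qed

text \<open>Otherwise \<open>r\<close> would divide \<open>2\<close>. This rules out the exponent
  \<open>0\<close>, so the bound \<open>t \<ge> 1\<close> in \<open>neg_one_exponent\<close> follows
  from the congruence.\<close>

lemma not_cong_one_neg_one: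
  assumes "r > 2"
  shows "\<not> [(1 :: int) = - 1] (mod int r)"
  using assms zdvd_imp_le[of "int r" 2] by (auto simp: cong_iff_dvd_diff)

text \<open>Once one power of \<open>2\<close> equals \<open>-1\<close>, the other solutions are the
  exponents giving the same power, and \<open>2\<close> is a unit modulo the odd
  \<open>r\<close>.\<close>

lemma neg_one_exponent_iff_cong:
  assumes "r > 2" "odd r" "neg_one_exponent r s"
  shows "neg_one_exponent r t \<longleftrightarrow> [t = s] (mod ord r 2)"
proof -
  have s: "[(2::int) ^ s = - 1] (mod int r)" using assms(3) by (simp add: neg_one_exponent_def)
  have "t \<ge> 1" if "[(2::int) ^ t = - 1] (mod int r)"
    using that not_cong_one_neg_one[OF assms(1)] by (cases t) auto
  then have "neg_one_exponent r t \<longleftrightarrow> [(2::int) ^ t = - 1] (mod int r)"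
    by (auto simp: neg_one_exponent_def)
  also have "\<dots> \<longleftrightarrow> [(2::int) ^ t = 2 ^ s] (mod int r)"
    using s by (simp add: cong_def)
  also have "\<dots> \<longleftrightarrow> [(2::nat) ^ t = 2 ^ s] (mod r)"
    using cong_int_iff[of "2 ^ t" "2 ^ s" r] by simp
  also have "\<dots> \<longleftrightarrow> [t = s] (mod ord r 2)"
    using assms(2) by (intro order_divides_expdiff) simp
  finally show ?thesis .
qed

text \<open>Reducing the least solution \<open>s\<close> modulo the order gives another solution, so
  \<open>s\<close> is below the order by minimality. Squaring shows that the order divides
  \<open>2 * s\<close>, which is positive and less than twice the order.\<close>

lemma ord_two_eq_double_Least:
  assumes "r > 2" "odd r" "\<exists>t. neg_one_exponent r t"
  shows "ord r 2 = 2 * (LEAST t. neg_one_exponent r t)"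
proof -
  define s where "s = (LEAST t. neg_one_exponent r t)"
  have s: "neg_one_exponent r s"
    unfolding s_def using assms(3) by (rule LeastI_ex)
  have m: "ord r 2 > 0" using assms(2) by simp
  have "neg_one_exponent r (s mod ord r 2)"
    using neg_one_exponent_iff_cong[OF assms(1,2) s] by (simp add: cong_def)
  then have "s \<le> s mod ord r 2" unfolding s_def by (rule Least_le)
  also have "\<dots> < ord r 2" using m by simp
  finally have less: "s < ord r 2" .
  have "[((2::int) ^ s)\<^sup>2 = (- 1)\<^sup>2] (mod int r)"
    using s unfolding neg_one_exponent_def by (intro cong_pow) simp
  then have "[int (2 ^ (2 * s)) = int 1] (mod int r)"
    by (simp add: power_even_eq)
  then have "ord r 2 dvd 2 * s"
    by (simp only: cong_int_iff ord_divides)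
  then obtain c where c: "2 * s = ord r 2 * c" ..
  have "s \<ge> 1" using s by (simp add: neg_one_exponent_def)
  with c have "c \<noteq> 0" by (intro notI) simp
  moreover have "c < 2"
  proof (rule ccontr)
    assume "\<not> c < 2"
    then have "ord r 2 * 2 \<le> ord r 2 * c" by (intro mult_le_mono2) simp
    with c less show False by linarith
  qed
  ultimately have "c = 1" by linarith
  with c show ?thesis by (simp add: s_def)
qed

lemma neg_one_in_gen_two_iff:
  assumes "r > 2" "odd r"
  shows "neg_one_in_gen_two r \<longleftrightarrow> (\<exists>t. neg_one_exponent r t)"
proof -
  define R where "R = residue_ring (int r)"
  interpret residues "int r" R
    by unfold_locales (use assms R_def in auto)
  interpret U: group "units_of R" by (rule units_group)
  have two: "2 mod int r \<in> Units R"
    using assms by (simp add: res_units_eq coprime_commute)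
  \<comment> \<open>In a finite group inverses are themselves natural powers, so the generated
    subgroup consists of the powers with exponent in \<open>nat\<close>.\<close>
  have "finite (carrier (units_of R))" by (simp add: units_of_carrier)
  then have "generate (units_of R) {2 mod int r} = {(2 mod int r) [^]\<^bsub>units_of R\<^esub> k |k. k \<in> (UNIV :: nat set)}"
    using two by (intro U.generate_pow_on_finite_carrier) (simp_all add: units_of_carrier)
  also have "\<dots> = {2 ^ k mod int r |k. True}"
    using two by (simp add: units_of_pow pow_cong)
  finally have "neg_one_in_gen_two r \<longleftrightarrow> (\<exists>t. [(2::int) ^ t = - 1] (mod int r))"
    by (auto simp: neg_one_in_gen_two_def R_def cong_def eq_commute)
  also have "\<dots> \<longleftrightarrow> (\<exists>t. neg_one_exponent r t)"
  proof -
    have "t \<ge> 1" if "[(2::int) ^ t = - 1] (mod int r)" for t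
      using that not_cong_one_neg_one[OF assms(1)] by (cases t) auto
    then show ?thesis by (auto simp: neg_one_exponent_def)
  qed
  finally show ?thesis .
qed

lemma infinite_cong_class:
  assumes "m > 0"
  shows "infinite {k::nat. [int k = a] (mod int m)}"
proof -
  \<comment> \<open>The least nonnegative representative of the class; \<open>nat\<close> loses
    nothing here.\<close>
  define b where "b = nat (a mod int m)"
  have b: "int b = a mod int m" using assms by (simp add: b_def)
  have "range (\<lambda>j. b + m * j) \<subseteq> {k. [int k = a] (mod int m)}"
    using b by (auto simp: cong_def)
  moreover have "inj (\<lambda>j. b + m * j)" using assms by (auto intro: injI)
  ultimately show ?thesis
    by (metis infinite_super range_inj_infinite)
qed

theorem theorem4p4:
  fixes p r m :: nat
  assumes "prime p" and "odd p" and "p \<ge> 5" and "[p = 3] (mod 4)"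
    and "p - 1 = 2 * r" and "r > 1" and "odd r"
    and "m = ord r 2"
  shows "((\<exists>k. 2 * p \<in> S k) \<longleftrightarrow> neg_one_in_gen_two r)
    \<and> (neg_one_in_gen_two r \<longleftrightarrow>
         (\<exists>t. neg_one_exponent r t) \<and> m = 2 * (LEAST t. neg_one_exponent r t))
    \<and> ((\<exists>k. 2 * p \<in> S k) \<or> neg_one_in_gen_two r \<or>
         ((\<exists>t. neg_one_exponent r t) \<and> m = 2 * (LEAST t. neg_one_exponent r t))
       \<longrightarrow> (let t0 = (LEAST t. neg_one_exponent r t) in
             infinite {k. 2 * p \<in> S k}
             \<and> {k. 2 * p \<in> S k} = {k. [int k = int t0 - 1] (mod (2 * int t0))}
             \<and> even m
             \<and> {k. 2 * p \<in> S k} = {k. [int k = int (m div 2) - 1] (mod int m)}))"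
proof -
  have p: "p = 2 * r + 1" using assms(3,5) by linarith
  \<comment> \<open>Oddness excludes \<open>r = 2\<close>; this is what separates \<open>1\<close>
    from \<open>-1\<close> modulo \<open>r\<close>.\<close>
  have r: "r > 2" using assms(6,7) by (cases "r = 2") auto
  define t0 where "t0 = (LEAST t. neg_one_exponent r t)"
  note mem_S = two_prime_mem_S_iff[OF assms(1) p]
  have S_ex: "(\<exists>k. 2 * p \<in> S k) \<longleftrightarrow> (\<exists>t. neg_one_exponent r t)"
  proof
    assume "\<exists>t. neg_one_exponent r t"
    then obtain t where t: "neg_one_exponent r t" ..
    \<comment> \<open>The witness is \<open>k = t - 1\<close>; truncated subtraction is harmless
      because \<open>t \<ge> 1\<close>.\<close>
    then have "t = (t - 1) + 1" by (simp add: neg_one_exponent_def)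
    with t mem_S show "\<exists>k. 2 * p \<in> S k" by metis
  qed (use mem_S in blast)
  note gen = neg_one_in_gen_two_iff[OF r assms(7)]
  \<comment> \<open>Hence the equation for \<open>m\<close> in (iii) is automatic once a solution
    exists.\<close>
  have m: "m = 2 * t0" if "\<exists>t. neg_one_exponent r t"
    using ord_two_eq_double_Least[OF r assms(7) that] assms(8) by (simp add: t0_def)
  have "infinite {k. 2 * p \<in> S k}
      \<and> {k. 2 * p \<in> S k} = {k. [int k = int t0 - 1] (mod (2 * int t0))}
      \<and> even m
      \<and> {k. 2 * p \<in> S k} = {k. [int k = int (m div 2) - 1] (mod int m)}"
    if ex: "\<exists>t. neg_one_exponent r t"
  proof -
    have t0: "neg_one_exponent r t0" unfolding t0_def using ex by (rule LeastI_ex)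
    have "2 * p \<in> S k \<longleftrightarrow> [int k = int t0 - 1] (mod int m)" for k
    proof -
      have "2 * p \<in> S k \<longleftrightarrow> [k + 1 = t0] (mod m)"
        using mem_S neg_one_exponent_iff_cong[OF r assms(7) t0] assms(8) by simp
      \<comment> \<open>Over the integers the shift by \<open>1\<close> can be moved to the other
        side.\<close>
      also have "\<dots> \<longleftrightarrow> [int (k + 1) = int t0] (mod int m)"
        by (simp only: cong_int_iff)
      also have "\<dots> \<longleftrightarrow> [int k = int t0 - 1] (mod int m)"
        by (simp add: cong_iff_dvd_diff algebra_simps)
      finally show ?thesis .
    qed
    then have eq: "{k. 2 * p \<in> S k} = {k. [int k = int t0 - 1] (mod int m)}" by blast
    have "m > 0" using t0 m[OF ex] by (simp add: neg_one_exponent_def)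
    then have "infinite {k. 2 * p \<in> S k}" unfolding eq by (rule infinite_cong_class)
    with eq m[OF ex] show ?thesis by simp
  qed
  then show ?thesis
    using S_ex gen m unfolding Let_def t0_def[symmetric] by blast
qed

end
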